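(* Let $h\in C^\infty(\mathbb T^2,\mathbb R)$ with $\#\mathcal M_h<\infty$, and let $\Gamma$ be the subgroup of $\mathbb Z^2$ generated by $\mathcal M_h$. (1) If $\mathrm{span}\,\Gamma=\mathbb R^2$, then $$\mathrm{Lie}\{\overrightarrow{h}+u: u\in\mathbb R^2\}=\mathrm{span}\{\overrightarrow{\cos}\langle m,\cdot\rangle,\ \overrightarrow{\sin}\langle m,\cdot\rangle,\ \partial_x,\ \partial_y : m\in\Gamma\}.$$ (2) If $\mathrm{span}\,\Gamma$ is of dimension $1$, then $$\mathrm{Lie}\{\overrightarrow{h}+u: u\in\mathbb R^2\}=\mathrm{Lie}\{\overrightarrow{\cos}\langle m,\cdot\rangle,\ \overrightarrow{\sin}\langle m,\cdot\rangle,\ \partial_x,\ \partial_y : m\in\mathcal M_h\}.$$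
   Context: $\mathbb T^2=\mathbb R^2/2\pi\mathbb Z^2$ with coordinates $(x,y)$. For a smooth function $a$ on $\mathbb T^2$, $\overrightarrow a=-\frac{\partial a}{\partial y}\partial_x+\frac{\partial a}{\partial x}\partial_y$ is its Hamiltonian vector field; $\overrightarrow{\cos}\langle m,\cdot\rangle$ and $\overrightarrow{\sin}\langle m,\cdot\rangle$ are the Hamiltonian vector fields of the functions $q\mapsto\cos\langle m,q\rangle$ and $q\mapsto\sin\langle m,q\rangle$. $\mathcal M_h$ is the set of $m\in\mathbb Z^2$ whose Fourier coefficient $h_m$ in $h=\sum_m h_me^{i\langle m,\cdot\rangle}$ is nonzero. $u\in\mathbb R^2$ is identified with the constant vector field $u_1\partial_x+u_2\partial_y$. $\mathrm{Lie}\,S$ is the real Lie algebra of vector fields generated by $S$ (no closure taken), and span is the real linear span. *)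

theory Defs
  imports
    "HOL-Analysis.Analysis"
    "HOL-Library.Function_Algebras"
    "HOL-Computational_Algebra.Group_Closure"
begin

text \<open>Pointwise real vector space structure on functions, so that the library's \<open>span\<close> and
  \<open>subspace\<close> apply to vector fields.\<close>

instantiation "fun" :: (type, real_vector) real_vector
begin

definition scaleR_fun :: "real \<Rightarrow> ('a \<Rightarrow> 'b) \<Rightarrow> 'a \<Rightarrow> 'b" where
  "scaleR_fun c f = (\<lambda>x. c *\<^sub>R f x)"

instance
  by standard (simp_all add: scaleR_fun_def fun_eq_iff scaleR_add_right scaleR_add_left)

end

text \<open>Class \<open>C\<^sup>k\<close>: in finite dimension it suffices that every directional derivative is of
  class \<open>C\<^sup>k\<^sup>-\<^sup>1\<close>.\<close>

primrec C_k :: "nat \<Rightarrow> ('a::euclidean_space \<Rightarrow> 'b::real_normed_vector) \<Rightarrow> bool" where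
  "C_k 0 f \<longleftrightarrow> continuous_on UNIV f"
| "C_k (Suc k) f \<longleftrightarrow>
     (\<forall>x. f differentiable (at x)) \<and> (\<forall>v. C_k k (\<lambda>x. frechet_derivative f (at x) v))"

definition smooth :: "('a::euclidean_space \<Rightarrow> 'b::real_normed_vector) \<Rightarrow> bool" where
  "smooth f \<longleftrightarrow> (\<forall>k. C_k k f)"

text \<open>Functions and vector fields on \<open>\<real>\<^sup>2 / 2\<pi>\<int>\<^sup>2\<close> are represented by their lifts: functions on
  the plane that are \<open>2\<pi>\<close>-periodic in each coordinate.\<close>

type_synonym point = "real \<times> real"
type_synonym vfield = "point \<Rightarrow> real \<times> real"

definition of_lattice :: "int \<times> int \<Rightarrow> real \<times> real" where
  "of_lattice m = (real_of_int (fst m), real_of_int (snd m))"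

definition torus_periodic :: "(point \<Rightarrow> 'b) \<Rightarrow> bool" where
  "torus_periodic f \<longleftrightarrow> (\<forall>q m. f (q + (2 * pi) *\<^sub>R of_lattice m) = f q)"

definition torus_smooth :: "(point \<Rightarrow> 'b::real_normed_vector) \<Rightarrow> bool" where
  "torus_smooth f \<longleftrightarrow> smooth f \<and> torus_periodic f"

definition partial_x :: "(point \<Rightarrow> real) \<Rightarrow> point \<Rightarrow> real" where
  "partial_x a q = frechet_derivative a (at q) (1, 0)"

definition partial_y :: "(point \<Rightarrow> real) \<Rightarrow> point \<Rightarrow> real" where
  "partial_y a q = frechet_derivative a (at q) (0, 1)"

definition hamiltonian :: "(point \<Rightarrow> real) \<Rightarrow> vfield" where
  "hamiltonian a = (\<lambda>q. (- partial_y a q, partial_x a q))"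

definition const_field :: "real \<times> real \<Rightarrow> vfield" where
  "const_field u = (\<lambda>_. u)"

definition cos_mode :: "int \<times> int \<Rightarrow> point \<Rightarrow> real" where
  "cos_mode m q = cos (of_lattice m \<bullet> q)"

definition sin_mode :: "int \<times> int \<Rightarrow> point \<Rightarrow> real" where
  "sin_mode m q = sin (of_lattice m \<bullet> q)"

definition fourier_coeff :: "(point \<Rightarrow> real) \<Rightarrow> int \<times> int \<Rightarrow> complex" where
  "fourier_coeff h m =
     integral (cbox (0, 0) (2 * pi, 2 * pi))
       (\<lambda>q. complex_of_real (h q) * exp (- (\<i> * complex_of_real (of_lattice m \<bullet> q))))
     / complex_of_real ((2 * pi)\<^sup>2)"

definition fourier_modes :: "(point \<Rightarrow> real) \<Rightarrow> (int \<times> int) set" where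
  "fourier_modes h = {m. fourier_coeff h m \<noteq> 0}"

definition trig_fields :: "(int \<times> int) set \<Rightarrow> vfield set" where
  "trig_fields M =
     (\<lambda>m. hamiltonian (cos_mode m)) ` M \<union> (\<lambda>m. hamiltonian (sin_mode m)) ` M \<union>
     {const_field (1, 0), const_field (0, 1)}"

definition lie_bracket :: "vfield \<Rightarrow> vfield \<Rightarrow> vfield" where
  "lie_bracket X Y =
     (\<lambda>q. frechet_derivative Y (at q) (X q) - frechet_derivative X (at q) (Y q))"

definition lie_algebra_of_fields :: "vfield set \<Rightarrow> bool" where
  "lie_algebra_of_fields L \<longleftrightarrow>
     L \<subseteq> {X. torus_smooth X} \<and> subspace L \<and> (\<forall>X\<in>L. \<forall>Y\<in>L. lie_bracket X Y \<in> L)"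

definition Lie :: "vfield set \<Rightarrow> vfield set" where
  "Lie S = lie_algebra_of_fields hull S"

text \<open>The smooth vector fields on the torus themselves form such a Lie algebra, so \<open>Lie S\<close> is an
  intersection of a nonempty family whenever \<open>S\<close> consists of smooth vector fields.\<close>

lemma C_k_continuous: "C_k k f \<Longrightarrow> continuous_on UNIV f"
  by (cases k) (auto intro!: differentiable_imp_continuous_on simp: differentiable_on_def
      differentiable_at_withinI)

lemma C_k_Suc_imp: "C_k (Suc k) f \<Longrightarrow> C_k k f"
proof (induction k arbitrary: f)
  case 0
  then show ?case using C_k_continuous[of "Suc 0" f] by simp
next
  case (Suc k)
  then show ?case by (simp only: C_k.simps(2)) blast
qed

lemma C_k_const: "C_k k (\<lambda>_. c)"
proof (induction k arbitrary: c)
  case (Suc k)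
  show ?case using Suc[of 0] by simp
qed simp

lemma C_k_SucI:
  assumes "\<And>x. (f has_derivative f' x) (at x)" "\<And>v. C_k k (\<lambda>x. f' x v)"
  shows "C_k (Suc k) f"
proof -
  have "frechet_derivative f (at x) = f' x" for x
    using assms(1)[of x] frechet_derivative_at by metis
  then show ?thesis using assms by (auto simp: differentiable_def)
qed

lemma C_k_SucD:
  assumes "C_k (Suc k) f"
  shows "(f has_derivative frechet_derivative f (at x)) (at x)"
    and "C_k k (\<lambda>x. frechet_derivative f (at x) v)"
  using assms by (auto simp: frechet_derivative_works)

lemma C_k_add: "C_k k f \<Longrightarrow> C_k k g \<Longrightarrow> C_k k (\<lambda>x. f x + g x)"
proof (induction k arbitrary: f g)
  case (Suc k)
  show ?case
    by (rule C_k_SucI[OF has_derivative_add[OF C_k_SucD(1)[OF Suc.prems(1)] C_k_SucD(1)[OF Suc.prems(2)]]])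
      (intro Suc.IH C_k_SucD(2) Suc.prems)
qed (auto intro: continuous_intros)

lemma C_k_sum: "(\<And>i. i \<in> I \<Longrightarrow> C_k k (f i)) \<Longrightarrow> C_k k (\<lambda>x. \<Sum>i\<in>I. f i x)"
  by (induction I rule: infinite_finite_induct) (auto intro: C_k_const C_k_add)

lemma C_k_scaleR: "C_k k f \<Longrightarrow> C_k k g \<Longrightarrow> C_k k (\<lambda>x. f x *\<^sub>R g x)"
proof (induction k arbitrary: f g)
  case (Suc k)
  show ?case
    by (rule C_k_SucI[OF has_derivative_scaleR[OF C_k_SucD(1)[OF Suc.prems(1)] C_k_SucD(1)[OF Suc.prems(2)]]])
      (intro C_k_add Suc.IH C_k_SucD(2) Suc.prems C_k_Suc_imp[OF Suc.prems(1)] C_k_Suc_imp[OF Suc.prems(2)])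
qed (auto intro: continuous_intros)

lemma C_k_inner_left: "C_k k f \<Longrightarrow> C_k k (\<lambda>x. f x \<bullet> b)"
proof (induction k arbitrary: f)
  case (Suc k)
  show ?case
    by (rule C_k_SucI[OF has_derivative_inner_left[OF C_k_SucD(1)[OF Suc.prems]]])
      (intro Suc.IH C_k_SucD(2) Suc.prems)
qed (auto intro: continuous_intros)

lemma has_derivative_shift:
  assumes "\<And>x. X (x + p) = X x" "(X has_derivative D) (at (q + p))"
  shows "(X has_derivative D) (at q)"
proof -
  have "((\<lambda>x. x + p) has_derivative (\<lambda>v. v)) (at q)"
    by (auto intro!: derivative_eq_intros)
  from has_derivative_compose[OF this assms(2)] show ?thesis
    by (simp only: assms(1))
qed

lemma frechet_derivative_periodic:
  assumes "torus_periodic X"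
  shows "frechet_derivative X (at (q + (2 * pi) *\<^sub>R of_lattice m)) = frechet_derivative X (at q)"
proof -
  let ?p = "(2 * pi) *\<^sub>R of_lattice m"
  have p: "X (x + ?p) = X x" for x
    using assms unfolding torus_periodic_def by blast
  have n: "X (x + - ?p) = X x" for x
    using p[of "x - ?p"] by (simp add: algebra_simps)
  have "(X has_derivative D) (at (q + ?p)) = (X has_derivative D) (at q)" for D
    using has_derivative_shift[where p = ?p and q = q and X = X and D = D, OF p]
      has_derivative_shift[where p = "- ?p" and q = "q + ?p" and X = X and D = D, OF n]
    by auto
  then show ?thesis
    unfolding frechet_derivative_def by simp
qed

lemma smooth_bracket_term:
  assumes "smooth X" "smooth (Y :: vfield)"
  shows "C_k k (\<lambda>q. frechet_derivative Y (at q) (X q :: real \<times> real))"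
proof -
  have X: "C_k k X" and Y: "C_k (Suc k) Y"
    using assms unfolding smooth_def by blast+
  have "frechet_derivative Y (at q) (X q)
      = (\<Sum>b\<in>Basis. (X q \<bullet> b) *\<^sub>R frechet_derivative Y (at q) b)" for q
  proof -
    have l: "linear (frechet_derivative Y (at q))"
      using C_k_SucD(1)[OF Y] has_derivative_linear by blast
    show ?thesis
      using linear_sum[OF l, of "\<lambda>b. (X q \<bullet> b) *\<^sub>R b" Basis]
      by (simp add: euclidean_representation linear_cmul[OF l])
  qed
  then show ?thesis
    by (simp only:) (intro C_k_sum C_k_scaleR C_k_inner_left X C_k_SucD(2)[OF Y])
qed

lemma lie_algebra_of_all_fields: "lie_algebra_of_fields {X. torus_smooth X}"
  unfolding lie_algebra_of_fields_def
proof (intro conjI ballI)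
  have mult: "C_k k (\<lambda>x. c *\<^sub>R f x)" if "C_k k f" for k c and f :: vfield
    using C_k_scaleR[OF C_k_const that] .
  show "subspace {X :: vfield. torus_smooth X}"
    unfolding subspace_def torus_smooth_def smooth_def torus_periodic_def
    by (auto simp: scaleR_fun_def zero_fun_def plus_fun_def intro: C_k_const C_k_add mult)
  fix X Y :: vfield assume "X \<in> {X. torus_smooth X}" "Y \<in> {X. torus_smooth X}"
  then have s: "smooth X" "smooth Y" and p: "torus_periodic X" "torus_periodic Y"
    by (auto simp: torus_smooth_def)
  have "smooth (lie_bracket X Y)"
    unfolding smooth_def lie_bracket_def
    using C_k_add[OF smooth_bracket_term[OF s] mult[OF smooth_bracket_term[OF s(2,1)], of _ "-1"]]
    by simp
  moreover have "torus_periodic (lie_bracket X Y)"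
    using p frechet_derivative_periodic[OF p(1)] frechet_derivative_periodic[OF p(2)]
    by (simp add: torus_periodic_def lie_bracket_def)
  ultimately show "lie_bracket X Y \<in> {X. torus_smooth X}"
    by (simp add: torus_smooth_def)
qed simp

end

theory Submission
  imports Defs
begin

text \<open>A constant field \<open>u\<close> acts on the Hamiltonian fields of mode \<open>m\<close> by \<open>[u, W] = \<langle>m, u\<rangle> W'\<close>, where \<open>W'\<close>
  is \<open>W\<close> with its phase advanced by a quarter turn. Bracketing twice with \<open>u\<close> is thus diagonal with
  eigenvalue \<open>- \<langle>m, u\<rangle>\<^sup>2\<close> on mode \<open>m\<close>, and for \<open>u\<close> of irrational slope these eigenvalues distinguish all
  modes up to sign. Since \<open>h\<close> is the finite sum of its Fourier modes (\<open>fourier_expansion\<close>), any Lie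
  algebra that contains every \<open>H\<^sub>h + u\<close>, where \<open>H\<^sub>h\<close> is the Hamiltonian field of \<open>h\<close>, contains each mode
  of \<open>h\<close> separately, with all phases (\<open>lie_algebra_contains_modes\<close>). Conversely \<open>H\<^sub>h\<close> is a linear
  combination of these fields. The fields \<open>H\<^sub>h + u\<close> and the trigonometric fields of the modes of \<open>h\<close>
  therefore generate the same Lie algebra (\<open>generators_subset_iff\<close>), which is the second equality.

  For the first equality, the bracket of fields of modes \<open>m\<close> and \<open>n\<close> is a combination of fields of
  modes \<open>m + n\<close> and \<open>m - n\<close> with the factor \<open>m\<^sub>1 n\<^sub>2 - m\<^sub>2 n\<^sub>1\<close> (\<open>lie_bracket_waves\<close>). This shows that the
  trigonometric fields over a subgroup span a Lie algebra (\<open>lie_algebra_trig_fields\<close>). It also shows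
  that a Lie algebra containing two transversal modes contains their sum. Once the modes span the
  plane, parallel modes can be added through a third, transversal one, so the available modes form
  a subgroup (\<open>lie_algebra_contains_group_closure\<close>).

  The Fourier expansion itself rests on the uniqueness of Fourier coefficients, obtained from
  Weierstrass approximation on a product of two circles (\<open>trig_polys_dense\<close>).\<close>

section \<open>Trigonometric polynomials on the torus\<close>

text \<open>Carrying a phase \<open>\<phi>\<close> treats cosine and sine alike: both are waves, differentiation advances the
  phase by a quarter turn, and products of waves are sums of waves.\<close>

definition wave :: "int \<times> int \<Rightarrow> real \<Rightarrow> point \<Rightarrow> real" where
  "wave m \<phi> q = cos (of_lattice m \<bullet> q + \<phi>)"

lemma of_lattice_simps:
  "of_lattice 0 = 0"
  "of_lattice (m + n) = of_lattice m + of_lattice n"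
  "of_lattice (m - n) = of_lattice m - of_lattice n"
  "of_lattice (- m) = - of_lattice m"
  by (simp_all add: of_lattice_def zero_prod_def plus_prod_def minus_prod_def uminus_prod_def)

abbreviation torus_cell :: "point set" where
  "torus_cell \<equiv> cbox (0, 0) (2 * pi, 2 * pi)"

lemma torus_periodic_cell:
  assumes "torus_periodic f"
  obtains p where "p \<in> torus_cell" "f p = f q" 
proof -
  define m :: "int \<times> int" where "m = (- \<lfloor>fst q / (2 * pi)\<rfloor>, - \<lfloor>snd q / (2 * pi)\<rfloor>)"
  have reduce: "0 \<le> x + 2 * pi * real_of_int (- \<lfloor>x / (2 * pi)\<rfloor>) \<and>
      x + 2 * pi * real_of_int (- \<lfloor>x / (2 * pi)\<rfloor>) \<le> 2 * pi" for x :: real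
  proof -
    have "real_of_int \<lfloor>x / (2 * pi)\<rfloor> \<le> x / (2 * pi)" "x / (2 * pi) \<le> real_of_int \<lfloor>x / (2 * pi)\<rfloor> + 1"
      by linarith+
    then have "2 * pi * real_of_int \<lfloor>x / (2 * pi)\<rfloor> \<le> 2 * pi * (x / (2 * pi))"
        "2 * pi * (x / (2 * pi)) \<le> 2 * pi * (real_of_int \<lfloor>x / (2 * pi)\<rfloor> + 1)"
      by (intro mult_left_mono; simp)+
    then show ?thesis by (simp add: distrib_left)
  qed
  show thesis
  proof
    show "q + (2 * pi) *\<^sub>R of_lattice m \<in> torus_cell"
      using reduce[of "fst q"] reduce[of "snd q"]
      by (cases q) (auto simp: m_def of_lattice_def cbox_Pair_eq)
    show "f (q + (2 * pi) *\<^sub>R of_lattice m) = f q"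
      using assms unfolding torus_periodic_def by metis
  qed
qed

lemma torus_periodic_eqI:
  assumes f: "torus_periodic f" and "cis (fst p) = cis (fst q)" "cis (snd p) = cis (snd q)"
  shows "f p = f q"
proof -
  have *: "\<exists>k::int. x = y + 2 * pi * k" if "cis x = cis y" for x y
  proof -
    have "sin x = sin y" "cos x = cos y" using that by (auto simp: complex_eq_iff)
    then obtain k::int where "x = y + 2 * pi * k" using sin_cos_eq_iff[of x y] by auto
    then show ?thesis by blast
  qed
  obtain k l :: int where "fst p = fst q + 2 * pi * k" "snd p = snd q + 2 * pi * l"
    using *[OF assms(2)] *[OF assms(3)] by auto
  then have "p = q + (2 * pi) *\<^sub>R of_lattice (k, l)"
    by (simp add: of_lattice_def prod_eq_iff)
  then show ?thesis using f unfolding torus_periodic_def by metis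
qed

lemma wave_periodic: "torus_periodic (wave m \<phi>)"
  unfolding torus_periodic_def
proof (intro allI)
  fix q and n :: "int \<times> int"
  have "of_lattice m \<bullet> (q + (2 * pi) *\<^sub>R of_lattice n) + \<phi>
      = (of_lattice m \<bullet> q + \<phi>) + 2 * pi * real_of_int (fst m * fst n + snd m * snd n)"
    by (simp add: of_lattice_def inner_add_right inner_prod_def algebra_simps)
  then show "wave m \<phi> (q + (2 * pi) *\<^sub>R of_lattice n) = wave m \<phi> q"
    using sin_cos_eq_iff unfolding wave_def by (metis (no_types, opaque_lifting))
qed

lemma cis_lattice_periodic: "torus_periodic (\<lambda>q. cis (of_lattice m \<bullet> q))"
  using wave_periodic[of m 0] wave_periodic[of m "- pi / 2"]
  by (simp add: torus_periodic_def wave_def complex_eq_iff cos_diff sin_cos_eq[symmetric])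

lemma wave_mult:
  "wave m \<phi> q * wave n \<psi> q = (wave (m + n) (\<phi> + \<psi>) q + wave (m - n) (\<phi> - \<psi>) q) / 2"
  unfolding wave_def cos_times_cos by (simp add: of_lattice_simps inner_add_left inner_diff_left algebra_simps)

definition trig_polys :: "(point \<Rightarrow> real) set" where
  "trig_polys = span (range (\<lambda>(m, \<phi>). wave m \<phi>))"

lemma trig_polys_wave: "wave m \<phi> \<in> trig_polys"
  unfolding trig_polys_def by (rule span_base) (auto intro: range_eqI[of _ _ "(m, \<phi>)"])

lemma trig_polys_add: "p \<in> trig_polys \<Longrightarrow> p' \<in> trig_polys \<Longrightarrow> (\<lambda>q. p q + p' q) \<in> trig_polys"
  using span_add[of p _ p'] unfolding trig_polys_def plus_fun_def by simp

lemma trig_polys_scale: "p \<in> trig_polys \<Longrightarrow> (\<lambda>q. c * p q) \<in> trig_polys"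
  using span_scale[of p _ c] unfolding trig_polys_def scaleR_fun_def by simp

lemma trig_polys_const: "(\<lambda>q. c) \<in> trig_polys"
  using trig_polys_scale[OF trig_polys_wave[of 0 0], of c] by (simp add: wave_def of_lattice_simps)

lemma trig_polys_induct [consumes 1, case_names wave zero add scale]:
  assumes "p \<in> trig_polys"
    and "\<And>m \<phi>. P (wave m \<phi>)" "P (\<lambda>q. 0)" "\<And>p p'. P p \<Longrightarrow> P p' \<Longrightarrow> P (\<lambda>q. p q + p' q)"
    and "\<And>c p. P p \<Longrightarrow> P (\<lambda>q. c * p q)"
  shows "P p"
  using assms(1) unfolding trig_polys_def
proof (rule span_induct)
  show "subspace (Collect P)"
    using assms(3-) unfolding subspace_def zero_fun_def plus_fun_def scaleR_fun_def by simp
qed (use assms(2) in auto)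

lemma trig_polys_mult:
  assumes "p \<in> trig_polys" "p' \<in> trig_polys"
  shows "(\<lambda>q. p q * p' q) \<in> trig_polys"
  using assms(1)
proof (induction rule: trig_polys_induct)
  case (wave m \<phi>)
  show ?case using assms(2)
  proof (induction rule: trig_polys_induct)
    case (wave n \<psi>)
    show ?case
      using trig_polys_scale[OF trig_polys_add[OF trig_polys_wave trig_polys_wave], of "1 / 2" "m + n" "\<phi> + \<psi>" "m - n" "\<phi> - \<psi>"]
      by (simp add: wave_mult)
  next
    case (scale c p)
    then show ?case using trig_polys_scale[of _ c] by (simp add: algebra_simps)
  qed (simp_all add: trig_polys_const trig_polys_add distrib_left)
next
  case (scale c p)
  then show ?case using trig_polys_scale[of _ c] by (simp add: mult.assoc)
qed (simp_all add: trig_polys_const trig_polys_add distrib_right)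

definition torus_embedding :: "point \<Rightarrow> complex \<times> complex" where
  "torus_embedding q = (cis (fst q), cis (snd q))"

lemma continuous_torus_embedding: "continuous_on A torus_embedding"
  unfolding torus_embedding_def cis_conv_exp by (intro continuous_intros)

text \<open>A linear functional of \<open>torus_embedding q\<close> is a combination of the cosines and sines of the two
  coordinates, and trigonometric polynomials form an algebra.\<close>

lemma polynomial_embedding_trig_poly:
  assumes "real_polynomial_function g"
  shows "(\<lambda>q. g (torus_embedding q)) \<in> trig_polys"
  using assms
proof induction
  case (linear f)
  interpret f: bounded_linear f by fact
  have c: "(\<lambda>q. cos (fst q)) \<in> trig_polys" "(\<lambda>q. sin (fst q)) \<in> trig_polys"
      "(\<lambda>q. cos (snd q)) \<in> trig_polys" "(\<lambda>q. sin (snd q)) \<in> trig_polys"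
    using trig_polys_wave[of "(1, 0)" 0] trig_polys_wave[of "(1, 0)" "- pi / 2"]
      trig_polys_wave[of "(0, 1)" 0] trig_polys_wave[of "(0, 1)" "- pi / 2"]
    by (simp_all add: wave_def[abs_def] of_lattice_def inner_prod_def cos_diff sin_cos_eq[symmetric])
  have eq: "f (torus_embedding q) = f (1, 0) * cos (fst q) + f (\<i>, 0) * sin (fst q)
      + f (0, 1) * cos (snd q) + f (0, \<i>) * sin (snd q)" for q
  proof -
    have "torus_embedding q = cos (fst q) *\<^sub>R (1, 0) + sin (fst q) *\<^sub>R (\<i>, 0)
      + cos (snd q) *\<^sub>R (0, 1) + sin (snd q) *\<^sub>R (0, \<i>)"
      by (simp add: torus_embedding_def complex_eq_iff)
    then show ?thesis by (simp only: f.add f.scaleR) (simp add: mult.commute)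
  qed
  show ?case unfolding eq by (intro trig_polys_add trig_polys_scale c)
next
  case (const c)
  show ?case by (rule trig_polys_const)
next
  case (add f g)
  from add.IH show ?case by (rule trig_polys_add)
next
  case (mult f g)
  from mult.IH show ?case by (rule trig_polys_mult)
qed

text \<open>A continuous periodic function is a continuous function on the compact product of two circles in
  \<open>\<complex> \<times> \<complex>\<close>: the cell is compact, so its projection to that product is a closed map and continuity
  descends. On that compact set Weierstrass approximation by real polynomials applies, and these
  pull back to trigonometric polynomials.\<close>

lemma trig_polys_dense:
  fixes a :: "point \<Rightarrow> real"
  assumes a: "continuous_on UNIV a" "torus_periodic a" and "e > 0"
  obtains p where "p \<in> trig_polys" "\<And>q. \<bar>a q - p q\<bar> < e"
proof -
  let ?S = "torus_embedding ` torus_cell"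
  define lift where "lift z = a (SOME q. torus_embedding q = z)" for z
  have lift: "lift (torus_embedding q) = a q" for q
  proof -
    have "torus_embedding (SOME p. torus_embedding p = torus_embedding q) = torus_embedding q"
      by (rule someI[of _ q]) (rule refl)
    then show ?thesis unfolding lift_def
      by (intro torus_periodic_eqI[OF a(2)]) (simp_all add: torus_embedding_def)
  qed
  have S: "compact ?S"
    by (intro compact_continuous_image continuous_torus_embedding compact_cbox)
  have "continuous_on ?S lift"
    unfolding continuous_on_closed_vimage[OF compact_imp_closed[OF S]]
  proof (intro allI impI)
    fix B :: "real set" assume "closed B"
    have "lift -` B \<inter> ?S = torus_embedding ` (torus_cell \<inter> a -` B)"
      using lift by auto
    moreover have "compact (torus_cell \<inter> a -` B)"
      using \<open>closed B\<close> a(1) by (intro compact_Int_closed compact_cbox closed_vimage)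
    ultimately show "closed (lift -` B \<inter> ?S)"
      using compact_continuous_image[OF continuous_torus_embedding] compact_imp_closed by metis
  qed
  with S \<open>e > 0\<close> obtain g where g: "real_polynomial_function g" "\<And>z. z \<in> ?S \<Longrightarrow> \<bar>lift z - g z\<bar> < e"
    using Stone_Weierstrass_real_polynomial_function by metis
  show thesis
  proof
    show "(\<lambda>q. g (torus_embedding q)) \<in> trig_polys"
      by (rule polynomial_embedding_trig_poly[OF g(1)])
    have E: "torus_periodic torus_embedding"
      using cis_lattice_periodic[of "(1, 0)"] cis_lattice_periodic[of "(0, 1)"]
      by (simp add: torus_periodic_def torus_embedding_def of_lattice_def inner_prod_def)
    fix q
    obtain p where "p \<in> torus_cell" "torus_embedding p = torus_embedding q"
      using torus_periodic_cell[OF E] by blast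
    then have "torus_embedding q \<in> ?S" by (metis image_eqI)
    from g(2)[OF this] show "\<bar>a q - g (torus_embedding q)\<bar> < e"
      by (simp only: lift)
  qed
qed

lemma continuous_wave: "continuous_on A (wave m \<phi>)"
  unfolding wave_def[abs_def] by (intro continuous_intros)

lemma continuous_trig_poly: "p \<in> trig_polys \<Longrightarrow> continuous_on A p"
  by (induction rule: trig_polys_induct) (auto intro: continuous_intros continuous_wave)

section \<open>Fourier expansion\<close>

text \<open>Orthogonality to waves is orthogonality to all trigonometric polynomials \<open>p\<close>. If \<open>p\<close> is uniformly
  \<open>e\<close>-close to \<open>a\<close>, then \<open>\<integral>a\<^sup>2 = \<integral>a (a - p) \<le> e \<integral>\<bar>a\<bar>\<close>, so \<open>\<integral>a\<^sup>2 = 0\<close>.\<close>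

lemma orthogonal_to_waves_imp_zero:
  fixes a :: "point \<Rightarrow> real"
  assumes a: "continuous_on UNIV a" "torus_periodic a"
    and orth: "\<And>m \<phi>. integral torus_cell (\<lambda>q. a q * wave m \<phi> q) = 0"
  shows "a q = 0"
proof -
  have cont: "continuous_on torus_cell a" using a(1) continuous_on_subset by blast
  have int: "(\<lambda>q. a q * f q) integrable_on torus_cell" if "continuous_on torus_cell f" for f
    by (intro integrable_continuous continuous_intros cont that)
  have zero: "integral torus_cell (\<lambda>q. a q * p q) = 0" if "p \<in> trig_polys" for p
  proof -
    have "continuous_on torus_cell p \<and> integral torus_cell (\<lambda>q. a q * p q) = 0"
      using that
    proof (induction rule: trig_polys_induct)
      case (wave m \<phi>) then show ?case using orth continuous_wave by blast
    next
      case (add p p')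
      then show ?case using integral_add[OF int int, of p p'] by (auto intro: continuous_intros simp: distrib_left)
    next
      case (scale c p)
      then show ?case using integral_mult_right[of torus_cell c "\<lambda>q. a q * p q"]
        by (auto intro: continuous_intros simp: algebra_simps)
    qed simp
    then show ?thesis by simp
  qed
  define K where "K = integral torus_cell (\<lambda>q. \<bar>a q\<bar>)"
  have K: "K \<ge> 0" unfolding K_def by (intro integral_nonneg integrable_continuous continuous_intros cont) auto
  have sq0: "integral torus_cell (\<lambda>q. a q * a q) \<ge> 0" by (intro integral_nonneg int cont) auto
  have small: "integral torus_cell (\<lambda>q. a q * a q) \<le> e * K" if e: "e > 0" for e
  proof -
    obtain p where p: "p \<in> trig_polys" "\<And>q. \<bar>a q - p q\<bar> < e"
      using trig_polys_dense[OF a e] by blast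
    have "integral torus_cell (\<lambda>q. a q * a q)
        = integral torus_cell (\<lambda>q. a q * a q) - integral torus_cell (\<lambda>q. a q * p q)"
      using zero[OF p(1)] by simp
    also have "\<dots> = integral torus_cell (\<lambda>q. a q * a q - a q * p q)"
      by (intro integral_diff[symmetric] int cont continuous_trig_poly p)
    also have "\<dots> \<le> integral torus_cell (\<lambda>q. e * \<bar>a q\<bar>)"
    proof (intro integral_le)
      fix q
      have "a q * (a q - p q) \<le> \<bar>a q\<bar> * \<bar>a q - p q\<bar>" by (metis abs_ge_self abs_mult)
      also have "\<dots> \<le> \<bar>a q\<bar> * e" using p(2)[of q] by (intro mult_left_mono) auto
      finally show "a q * a q - a q * p q \<le> e * \<bar>a q\<bar>" by (simp add: algebra_simps)
    qed (intro integrable_continuous continuous_intros cont continuous_trig_poly p)+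
    also have "\<dots> = e * K" unfolding K_def by simp
    finally show ?thesis .
  qed
  have "integral torus_cell (\<lambda>q. a q * a q) = 0"
  proof (rule ccontr)
    assume "integral torus_cell (\<lambda>q. a q * a q) \<noteq> 0"
    with sq0 have pos: "integral torus_cell (\<lambda>q. a q * a q) > 0" by simp
    define I where "I = integral torus_cell (\<lambda>q. a q * a q)"
    \<comment> \<open>The choice of \<open>e\<close> makes \<open>e * K\<close> smaller than \<open>I\<close>; the summand 1 covers \<open>K = 0\<close>.\<close>
    have "I \<le> I / (2 * (K + 1)) * K" using small[of "I / (2 * (K + 1))"] pos K by (simp add: I_def)
    moreover have "I / (2 * (K + 1)) * K < I" using pos K unfolding I_def[symmetric] by (simp add: field_simps add_nonneg_pos)
    ultimately show False by simp
  qed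
  then have "\<forall>q\<in>torus_cell. a q * a q = 0"
    by (subst (asm) integral_cbox_eq_0_iff) (auto intro!: continuous_intros cont simp: box_ne_empty Basis_prod_def)
  moreover obtain p where "p \<in> torus_cell" "a p = a q" using torus_periodic_cell[OF a(2)] by blast
  ultimately show ?thesis by auto
qed

lemma integral_cis_period:
  "integral {0..2 * pi} (\<lambda>x. cis (real_of_int k * x)) = (if k = 0 then complex_of_real (2 * pi) else 0)"
proof (cases "k = 0")
  case False
  have "((\<lambda>x. cis (real_of_int k * x)) has_integral
      cis (real_of_int k * (2 * pi)) / (\<i> * of_int k) - cis (real_of_int k * 0) / (\<i> * of_int k)) {0..2 * pi}"
  proof (rule fundamental_theorem_of_calculus)
    fix x
    show "((\<lambda>x. cis (real_of_int k * x) / (\<i> * of_int k)) has_vector_derivative cis (real_of_int k * x)) (at x within {0..2 * pi})"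
    proof -
      have "((\<lambda>z. exp (\<i> * of_int k * z) / (\<i> * of_int k)) has_field_derivative exp (\<i> * of_int k * of_real x)) (at (of_real x))"
        using False by (auto intro!: derivative_eq_intros)
      from has_vector_derivative_real_field[OF this] show ?thesis
        by (simp add: cis_conv_exp mult.assoc)
    qed
  qed simp
  moreover have "cis (real_of_int k * (2 * pi)) = 1"
    using cos_int_2pin[of k] sin_int_2pin[of k] by (simp add: complex_eq_iff mult.commute mult.left_commute)
  ultimately show ?thesis using False by (simp add: integral_unique)
qed (simp add: scaleR_conv_of_real)

lemma integral_character:
  "integral torus_cell (\<lambda>q. cis (of_lattice k \<bullet> q)) = (if k = 0 then complex_of_real ((2 * pi)\<^sup>2) else 0)"
proof -
  have "integral torus_cell (\<lambda>q. cis (of_lattice k \<bullet> q))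
      = integral (cbox 0 (2 * pi)) (\<lambda>x. integral (cbox 0 (2 * pi)) (\<lambda>y. cis (of_lattice k \<bullet> (x, y))))"
    by (rule integral_prod_continuous) (auto intro!: continuous_intros simp: cis_conv_exp)
  also have "\<dots> = integral (cbox 0 (2 * pi)) (\<lambda>x. cis (fst k * x) * integral (cbox 0 (2 * pi)) (\<lambda>y. cis (snd k * y)))"
    by (simp add: of_lattice_def inner_prod_def cis_mult[symmetric] )
  also have "\<dots> = (if k = 0 then complex_of_real ((2 * pi)\<^sup>2) else 0)"
    using integral_cis_period[of "fst k"] integral_cis_period[of "snd k"]
    by (simp add: cbox_interval prod_eq_iff power2_eq_square)
  finally show ?thesis .
qed

lemma fourier_coeff_cis:
  "fourier_coeff h m = integral torus_cell (\<lambda>q. complex_of_real (h q) * cis (- (of_lattice m \<bullet> q))) / complex_of_real ((2 * pi)\<^sup>2)"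
  unfolding fourier_coeff_def cis_conv_exp by simp

lemma fourier_coeff_uminus: "fourier_coeff h (- m) = cnj (fourier_coeff h m)"
  unfolding fourier_coeff_cis by (simp add: of_lattice_simps integral_cnj cis_cnj)

text \<open>The difference of \<open>h\<close> and its finite Fourier series has vanishing Fourier coefficients, because
  distinct characters are orthogonal; hence its real part is orthogonal to every wave. Stating the
  result with real parts gives a real expansion over all modes, without pairing \<open>m\<close> with \<open>- m\<close>.\<close>

lemma fourier_expansion:
  assumes h: "torus_smooth h" and fin: "finite (fourier_modes h)"
  shows "h q = (\<Sum>m\<in>fourier_modes h. Re (fourier_coeff h m * cis (of_lattice m \<bullet> q)))"
proof -
  let ?M = "fourier_modes h" and ?c = "fourier_coeff h"
  have hc: "continuous_on A h" for A
    using h C_k_continuous[of 0 h] continuous_on_subset unfolding torus_smooth_def smooth_def by blast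
  have hp: "torus_periodic h" using h by (simp add: torus_smooth_def)
  have cc: "continuous_on A (\<lambda>q. cis (of_lattice m \<bullet> q))" for A m
    unfolding cis_conv_exp by (intro continuous_intros)
  define g where "g q = complex_of_real (h q) - (\<Sum>m\<in>?M. ?c m * cis (of_lattice m \<bullet> q))" for q
  have gc: "continuous_on A g" for A unfolding g_def by (intro continuous_intros hc cc)
  have zero: "integral torus_cell (\<lambda>q. g q * cis (of_lattice n \<bullet> q)) = 0" for n
  proof -
    have "integral torus_cell (\<lambda>q. g q * cis (of_lattice n \<bullet> q))
      = integral torus_cell (\<lambda>q. complex_of_real (h q) * cis (of_lattice n \<bullet> q) - (\<Sum>m\<in>?M. ?c m * cis (of_lattice (m + n) \<bullet> q)))"
      unfolding g_def by (simp add: left_diff_distrib sum_distrib_right of_lattice_simps inner_add_left cis_mult[symmetric] mult.assoc)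
    also have "\<dots> = integral torus_cell (\<lambda>q. complex_of_real (h q) * cis (of_lattice n \<bullet> q)) - integral torus_cell (\<lambda>q. \<Sum>m\<in>?M. ?c m * cis (of_lattice (m + n) \<bullet> q))"
      by (intro integral_diff integrable_continuous continuous_intros hc cc)
    also have "integral torus_cell (\<lambda>q. complex_of_real (h q) * cis (of_lattice n \<bullet> q)) = complex_of_real ((2 * pi)\<^sup>2) * ?c (- n)"
      unfolding fourier_coeff_cis by (simp add: of_lattice_simps)
    also have "integral torus_cell (\<lambda>q. \<Sum>m\<in>?M. ?c m * cis (of_lattice (m + n) \<bullet> q))
        = (\<Sum>m\<in>?M. ?c m * (if m + n = 0 then complex_of_real ((2 * pi)\<^sup>2) else 0))"
      by (subst integral_sum) (auto intro!: fin integrable_continuous continuous_intros cc simp: integral_character simp del: of_real_power)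
    also have "\<dots> = complex_of_real ((2 * pi)\<^sup>2) * ?c (- n)"
      using fin by (simp add: eq_neg_iff_add_eq_0[symmetric] if_distrib sum.delta fourier_modes_def mult.commute cong: if_cong)
    finally show ?thesis by simp
  qed
  have "Re (g q) = 0" for q
  proof (rule orthogonal_to_waves_imp_zero)
    show "continuous_on UNIV (\<lambda>q. Re (g q))" by (intro continuous_intros gc)
    show "torus_periodic (\<lambda>q. Re (g q))"
      using hp cis_lattice_periodic unfolding torus_periodic_def g_def by presburger
    fix m \<phi>
    \<comment> \<open>\<open>wave m \<phi>\<close> is half the sum of a character and its conjugate, each with a phase factor.\<close>
    have eq: "Re (g q) * wave m \<phi> q = Re (cis \<phi> / 2 * (g q * cis (of_lattice m \<bullet> q)) + cis (- \<phi>) / 2 * (g q * cis (of_lattice (- m) \<bullet> q)))" for q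
      by (simp add: wave_def of_lattice_simps cos_add field_simps)
    have i: "(\<lambda>q. c * (g q * cis (of_lattice n \<bullet> q))) integrable_on torus_cell" for c n
      by (intro integrable_continuous continuous_intros gc cc)
    have "integral torus_cell (\<lambda>q. Re (g q) * wave m \<phi> q) =
        Re (integral torus_cell (\<lambda>q. cis \<phi> / 2 * (g q * cis (of_lattice m \<bullet> q)) + cis (- \<phi>) / 2 * (g q * cis (of_lattice (- m) \<bullet> q))))"
      unfolding eq integral_linear[OF integrable_add[OF i i] bounded_linear_Re, unfolded o_def] ..
    also have "\<dots> = 0"
      by (subst integral_add[OF i i]) (simp add: zero)
    finally show "integral torus_cell (\<lambda>q. Re (g q) * wave m \<phi> q) = 0" .
  qed
  then show ?thesis by (simp add: g_def)
qed

section \<open>Wave fields\<close>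

definition perp :: "int \<times> int \<Rightarrow> real \<times> real" where
  "perp m = (- real_of_int (snd m), real_of_int (fst m))"

definition cross :: "int \<times> int \<Rightarrow> int \<times> int \<Rightarrow> int" where
  "cross m n = fst m * snd n - snd m * fst n"

text \<open>The Hamiltonian field of the wave with phase \<open>\<phi> - pi / 2\<close>. This one family contains the
  Hamiltonian fields of \<open>cos_mode m\<close> (\<open>\<phi> = pi / 2\<close>) and of \<open>sin_mode m\<close> (\<open>\<phi> = 0\<close>).\<close>

definition wave_field :: "int \<times> int \<Rightarrow> real \<Rightarrow> vfield" where
  "wave_field m \<phi> q = wave m \<phi> q *\<^sub>R perp m"

lemma perp_simps:
  "perp 0 = 0" "perp (m + n) = perp m + perp n" "perp (m - n) = perp m - perp n" "perp (- m) = - perp m"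
  by (simp_all add: perp_def prod_eq_iff)

lemma of_lattice_inner_perp: "of_lattice n \<bullet> perp m = real_of_int (cross m n)"
  by (simp add: of_lattice_def perp_def cross_def inner_prod_def)

lemma wave_field_zero: "wave_field 0 \<phi> = 0"
  by (simp add: fun_eq_iff wave_field_def perp_simps)

lemma wave_field_uminus: "wave_field (- m) \<phi> = - wave_field m (- \<phi>)"
proof
  fix q
  have "cos (- (of_lattice m \<bullet> q) + \<phi>) = cos (of_lattice m \<bullet> q + - \<phi>)"
    by (subst cos_minus[symmetric]) simp
  then show "wave_field (- m) \<phi> q = (- wave_field m (- \<phi>)) q"
    by (simp add: wave_field_def wave_def perp_simps of_lattice_simps)
qed

text \<open>All phases of a mode lie in the plane spanned by one phase and its quarter turn.\<close>

lemma wave_field_shift: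
  "wave_field m \<psi> = cos (\<psi> - \<phi>) *\<^sub>R wave_field m \<phi> + sin (\<psi> - \<phi>) *\<^sub>R wave_field m (\<phi> + pi / 2)"
proof
  fix q
  have "cos (of_lattice m \<bullet> q + \<psi>) = cos ((of_lattice m \<bullet> q + \<phi>) + (\<psi> - \<phi>))" by simp
  also have "\<dots> = cos (\<psi> - \<phi>) * cos (of_lattice m \<bullet> q + \<phi>) + sin (\<psi> - \<phi>) * cos (of_lattice m \<bullet> q + (\<phi> + pi / 2))"
    by (subst cos_add) (simp add: add.assoc[symmetric] cos_add[of _ "pi / 2"])
  finally show "wave_field m \<psi> q = (cos (\<psi> - \<phi>) *\<^sub>R wave_field m \<phi> + sin (\<psi> - \<phi>) *\<^sub>R wave_field m (\<phi> + pi / 2)) q"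
    by (simp add: wave_field_def wave_def scaleR_fun_def scaleR_add_left)
qed

text \<open>Bracketing twice with a constant field advances the phase by two quarter turns, so it acts on
  each mode as a scalar.\<close>

lemma wave_field_half_turn: "wave_field m (\<phi> + pi / 2 + pi / 2) = - wave_field m \<phi>"
proof
  fix q
  have "of_lattice m \<bullet> q + (\<phi> + pi / 2 + pi / 2) = (of_lattice m \<bullet> q + \<phi>) + pi" by simp
  then have "wave m (\<phi> + pi / 2 + pi / 2) q = - wave m \<phi> q"
    unfolding wave_def by (simp only: cos_periodic_pi)
  then show "wave_field m (\<phi> + pi / 2 + pi / 2) q = (- wave_field m \<phi>) q"
    unfolding wave_field_def by (simp only: wave_field_def uminus_apply scaleR_minus_left)
qed

lemma wave_has_derivative:
  "(wave m \<phi> has_derivative (\<lambda>v. (of_lattice m \<bullet> v) * wave m (\<phi> + pi / 2) q)) (at q)"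
proof -
  have "wave m (\<phi> + pi / 2) q = - sin (of_lattice m \<bullet> q + \<phi>)"
    by (simp add: wave_def add.assoc[symmetric] cos_add[of _ "pi / 2"])
  then show ?thesis unfolding wave_def[abs_def]
    by (auto intro!: derivative_eq_intros simp: wave_def)
qed

lemma wave_field_has_derivative:
  "(wave_field m \<phi> has_derivative (\<lambda>v. (of_lattice m \<bullet> v) *\<^sub>R wave_field m (\<phi> + pi / 2) q)) (at q)"
  using has_derivative_scaleR_left[OF wave_has_derivative[of m \<phi> q], of "perp m"]
  by (simp add: wave_field_def[abs_def])

lemma hamiltonianI:
  assumes "\<And>q. (a has_derivative D q) (at q)"
  shows "hamiltonian a = (\<lambda>q. (- D q (0, 1), D q (1, 0)))"
  unfolding hamiltonian_def partial_x_def partial_y_def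
  using frechet_derivative_at[OF assms] by metis

lemma hamiltonian_wave: "hamiltonian (wave m \<phi>) = wave_field m (\<phi> + pi / 2)"
  by (subst hamiltonianI[OF wave_has_derivative])
    (simp add: fun_eq_iff wave_field_def perp_def of_lattice_def inner_prod_def)

lemma trig_fields_wave:
  "trig_fields M = (\<lambda>m. wave_field m (pi / 2)) ` M \<union> (\<lambda>m. wave_field m 0) ` M \<union> {const_field (1, 0), const_field (0, 1)}"
proof -
  have "cos_mode m = wave m 0" "sin_mode m = wave m (- pi / 2)" for m
    by (simp_all add: fun_eq_iff cos_mode_def sin_mode_def wave_def cos_diff sin_cos_eq[symmetric])
  then show ?thesis by (simp add: trig_fields_def hamiltonian_wave)
qed

lemma C_k_wave_field: "C_k k (\<lambda>q. c *\<^sub>R wave_field m \<phi> q)"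
proof (induction k arbitrary: c \<phi>)
  case 0
  show ?case
    unfolding C_k.simps wave_field_def by (intro continuous_intros continuous_wave)
next
  case (Suc k)
  show ?case
    by (rule C_k_SucI[OF has_derivative_scaleR_right[OF wave_field_has_derivative]]) (simp add: Suc)
qed

lemma torus_smooth_wave_field: "torus_smooth (wave_field m \<phi>)"
  using C_k_wave_field[of _ 1] wave_periodic[of m \<phi>]
  by (simp add: torus_smooth_def smooth_def torus_periodic_def wave_field_def[abs_def])

lemma torus_smooth_const_field: "torus_smooth (const_field u)"
  by (simp add: torus_smooth_def smooth_def torus_periodic_def const_field_def C_k_const)

section \<open>Brackets of vector fields\<close>

lemma torus_smooth_has_derivative:
  "torus_smooth X \<Longrightarrow> (X has_derivative frechet_derivative X (at q)) (at q)"
  unfolding torus_smooth_def smooth_def using C_k_SucD(1) by blast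

lemma lie_bracketI:
  assumes "\<And>q. (X has_derivative X' q) (at q)" "\<And>q. (Y has_derivative Y' q) (at q)"
  shows "lie_bracket X Y = (\<lambda>q. Y' q (X q) - X' q (Y q))"
  unfolding lie_bracket_def
  using frechet_derivative_at[OF assms(1)] frechet_derivative_at[OF assms(2)] by metis

lemma const_field_has_derivative: "(const_field u has_derivative (\<lambda>v. 0)) (at q)"
  by (simp add: const_field_def)

lemma lie_bracket_antisym: "lie_bracket Y X = - lie_bracket X Y"
  by (simp add: lie_bracket_def fun_eq_iff)

lemma lie_bracket_add_right:
  assumes "torus_smooth X" "torus_smooth Y" "torus_smooth Z"
  shows "lie_bracket X (Y + Z) = lie_bracket X Y + lie_bracket X Z"
proof -
  have "((Y + Z) has_derivative (\<lambda>v. frechet_derivative Y (at q) v + frechet_derivative Z (at q) v)) (at q)" for q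
    unfolding plus_fun_def using assms by (intro has_derivative_add torus_smooth_has_derivative)
  moreover have "linear (frechet_derivative X (at q))" for q
    using torus_smooth_has_derivative[OF assms(1)] has_derivative_linear by blast
  ultimately show ?thesis
    by (subst lie_bracketI[OF torus_smooth_has_derivative[OF assms(1)]])
      (auto simp: lie_bracket_def fun_eq_iff linear_add)
qed

lemma lie_bracket_scale_right:
  assumes "torus_smooth X" "torus_smooth Y"
  shows "lie_bracket X (c *\<^sub>R Y) = c *\<^sub>R lie_bracket X Y"
proof -
  have "((c *\<^sub>R Y) has_derivative (\<lambda>v. c *\<^sub>R frechet_derivative Y (at q) v)) (at q)" for q
    unfolding scaleR_fun_def using assms by (intro has_derivative_scaleR_right torus_smooth_has_derivative)
  moreover have "linear (frechet_derivative X (at q))" for q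
    using torus_smooth_has_derivative[OF assms(1)] has_derivative_linear by blast
  ultimately show ?thesis
    by (subst lie_bracketI[OF torus_smooth_has_derivative[OF assms(1)]])
      (auto simp: lie_bracket_def fun_eq_iff linear_cmul scaleR_fun_def scaleR_diff_right)
qed

text \<open>The bracket is bilinear on smooth fields, so closure of the span can be tested on a spanning set.
  Linearity in the second argument is applied first, and antisymmetry transfers it to the first.\<close>

lemma lie_algebra_span:
  assumes smooth: "B \<subseteq> {X. torus_smooth X}"
    and bracket: "\<And>X Y. X \<in> B \<Longrightarrow> Y \<in> B \<Longrightarrow> lie_bracket X Y \<in> span B"
  shows "lie_algebra_of_fields (span B)"
proof -
  have sp: "span B \<subseteq> {X. torus_smooth X}"
    using lie_algebra_of_all_fields by (intro span_minimal smooth) (simp add: lie_algebra_of_fields_def)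
  have zero: "lie_bracket X 0 = 0" if "torus_smooth X" for X
    using lie_bracket_scale_right[OF that torus_smooth_const_field, of 0 0] by simp
  have ext: "lie_bracket X Y \<in> span B"
    if X: "torus_smooth X" "\<And>Y. Y \<in> B \<Longrightarrow> lie_bracket X Y \<in> span B" and Y: "Y \<in> span B" for X Y
  proof -
    have "torus_smooth Y \<and> lie_bracket X Y \<in> span B" using Y
    proof (induction rule: span_induct_alt)
      case base
      have "torus_smooth (0 :: vfield)" using sp span_zero[of B] by blast
      then show ?case using zero[OF X(1)] span_zero[of B] by (simp add: zero_fun_def)
    next
      case (step c x y)
      then have s: "torus_smooth x" "torus_smooth (c *\<^sub>R x)" "torus_smooth y"
        using smooth sp span_base span_scale by blast+
      have "torus_smooth (c *\<^sub>R x + y)"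
        using lie_algebra_of_all_fields s(2,3) subspace_add unfolding lie_algebra_of_fields_def by fast
      moreover have "lie_bracket X (c *\<^sub>R x + y) \<in> span B"
        using step X s by (simp add: lie_bracket_add_right lie_bracket_scale_right span_add span_scale)
      ultimately show ?case by (simp add: plus_fun_def)
    qed
    then show ?thesis by simp
  qed
  have "lie_bracket X Y \<in> span B" if X: "X \<in> span B" and Y: "Y \<in> span B" for X Y
  proof (rule ext[OF _ _ Y])
    show "torus_smooth X" using X sp by blast
    fix Z assume Z: "Z \<in> B"
    have "lie_bracket Z X \<in> span B"
      using ext[OF _ bracket X] Z smooth by blast
    then show "lie_bracket X Z \<in> span B"
      using lie_bracket_antisym[of X Z] span_neg by metis
  qed
  then show ?thesis using sp by (simp add: lie_algebra_of_fields_def)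
qed

lemma sum_fun_apply: "(\<Sum>i\<in>F. X i) q = (\<Sum>i\<in>F. X i q)"
  by (induction F rule: infinite_finite_induct) auto

lemma lie_bracket_const_waves:
  "lie_bracket (const_field u) (\<Sum>i\<in>F. c i *\<^sub>R wave_field (m i) (\<phi> i))
    = (\<Sum>i\<in>F. (c i * (of_lattice (m i) \<bullet> u)) *\<^sub>R wave_field (m i) (\<phi> i + pi / 2))"
proof -
  have "((\<Sum>i\<in>F. c i *\<^sub>R wave_field (m i) (\<phi> i)) has_derivative
      (\<lambda>v. \<Sum>i\<in>F. c i *\<^sub>R (of_lattice (m i) \<bullet> v) *\<^sub>R wave_field (m i) (\<phi> i + pi / 2) q)) (at q)" for q
    unfolding fun_eq_iff[THEN iffD2, OF allI, OF sum_fun_apply] scaleR_fun_def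
    by (intro has_derivative_sum has_derivative_scaleR_right wave_field_has_derivative)
  from lie_bracketI[OF const_field_has_derivative this]
  show ?thesis by (simp add: fun_eq_iff sum_fun_apply scaleR_fun_def const_field_def)
qed

lemma lie_bracket_const_wave:
  "lie_bracket (const_field u) (wave_field m \<phi>) = (of_lattice m \<bullet> u) *\<^sub>R wave_field m (\<phi> + pi / 2)"
  using lie_bracket_const_waves[of u "\<lambda>_. 1" "\<lambda>_. m" "\<lambda>_. \<phi>" "{()}"] by simp

text \<open>The Poisson bracket of two waves is \<open>cross m n\<close> times a product of two waves, which the
  product-to-sum formulas turn into waves of the modes \<open>m + n\<close> and \<open>m - n\<close>.\<close>

lemma lie_bracket_waves:
  "lie_bracket (wave_field m \<phi>) (wave_field n \<psi>) =
    (real_of_int (cross m n) / 2) *\<^sub>R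
      (wave_field (m + n) (\<phi> + \<psi> + pi / 2) + wave_field (m - n) (\<phi> - \<psi> + pi / 2))"
proof -
  have "(of_lattice n \<bullet> wave_field m \<phi> q) *\<^sub>R wave_field n (\<psi> + pi / 2) q
      - (of_lattice m \<bullet> wave_field n \<psi> q) *\<^sub>R wave_field m (\<phi> + pi / 2) q
    = (real_of_int (cross m n) / 2) *\<^sub>R
      (wave_field (m + n) (\<phi> + \<psi> + pi / 2) q + wave_field (m - n) (\<phi> - \<psi> + pi / 2) q)" for q
  proof -
    have c: "cross n m = - cross m n" by (simp add: cross_def algebra_simps)
    have 1: "wave m \<phi> q * wave n (\<psi> + pi / 2) q = (wave (m + n) (\<phi> + \<psi> + pi / 2) q - wave (m - n) (\<phi> - \<psi> + pi / 2) q) / 2"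
    proof -
      have "wave (m - n) (\<phi> - (\<psi> + pi / 2)) q = - wave (m - n) (\<phi> - \<psi> + pi / 2) q"
        by (simp add: wave_def cos_add cos_diff sin_diff sin_add algebra_simps)
      then show ?thesis by (simp add: wave_mult add.assoc)
    qed
    have 2: "wave n \<psi> q * wave m (\<phi> + pi / 2) q = (wave (m + n) (\<phi> + \<psi> + pi / 2) q + wave (m - n) (\<phi> - \<psi> + pi / 2) q) / 2"
      using wave_mult[of m "\<phi> + pi / 2" q n \<psi>] by (simp add: algebra_simps)
    have "(of_lattice n \<bullet> wave_field m \<phi> q) *\<^sub>R wave_field n (\<psi> + pi / 2) q
      - (of_lattice m \<bullet> wave_field n \<psi> q) *\<^sub>R wave_field m (\<phi> + pi / 2) q
      = real_of_int (cross m n) *\<^sub>R ((wave m \<phi> q * wave n (\<psi> + pi / 2) q) *\<^sub>R perp n + (wave n \<psi> q * wave m (\<phi> + pi / 2) q) *\<^sub>R perp m)"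
      by (simp add: wave_field_def of_lattice_inner_perp c scaleR_add_right algebra_simps)
    then show ?thesis unfolding 1 2 wave_field_def perp_simps
      by (simp add: prod_eq_iff field_simps)
  qed
  then show ?thesis
    by (subst lie_bracketI[OF wave_field_has_derivative wave_field_has_derivative])
      (simp add: fun_eq_iff scaleR_fun_def)
qed

section \<open>Lie algebras spanned by wave fields\<close>

lemma const_field_in_subspace:
  assumes "subspace L" "const_field (1, 0) \<in> L" "const_field (0, 1) \<in> L"
  shows "const_field u \<in> L"
proof -
  have "const_field u = fst u *\<^sub>R const_field (1, 0) + snd u *\<^sub>R const_field (0, 1)"
    by (simp add: fun_eq_iff const_field_def scaleR_fun_def)
  then show ?thesis using assms by (simp add: subspace_add subspace_scale)
qed

lemma trig_fields_subset_iff: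
  assumes "subspace L"
  shows "trig_fields M \<subseteq> L \<longleftrightarrow> (\<forall>m\<in>M. \<forall>\<phi>. wave_field m \<phi> \<in> L) \<and> (\<forall>u. const_field u \<in> L)"
proof (intro iffI conjI ballI allI)
  fix m \<phi> assume M: "trig_fields M \<subseteq> L" and m: "m \<in> M"
  then have "wave_field m 0 \<in> L" "wave_field m (0 + pi / 2) \<in> L"
    by (auto simp: trig_fields_wave)
  then show "wave_field m \<phi> \<in> L"
    using assms unfolding wave_field_shift[of m \<phi> 0] by (intro subspace_add subspace_scale)
next
  fix u assume "trig_fields M \<subseteq> L"
  then show "const_field u \<in> L"
    using const_field_in_subspace[OF assms] by (simp add: trig_fields_def)
qed (auto simp: trig_fields_wave)

text \<open>By the bracket formulas, two wave fields bracket to modes \<open>m + n\<close> and \<open>m - n\<close>, and a constant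
  field only changes the phase.\<close>

lemma lie_algebra_trig_fields:
  assumes minus: "\<And>m n. m \<in> G \<Longrightarrow> n \<in> G \<Longrightarrow> m - n \<in> G" 
    and add: "\<And>m n. m \<in> G \<Longrightarrow> n \<in> G \<Longrightarrow> m + n \<in> G"
  shows "lie_algebra_of_fields (span (trig_fields G))"
proof (rule lie_algebra_span)
  show "trig_fields G \<subseteq> {X. torus_smooth X}"
    by (auto simp: trig_fields_wave torus_smooth_wave_field torus_smooth_const_field)
  have w: "wave_field m \<phi> \<in> span (trig_fields G)" if "m \<in> G" for m \<phi>
    using trig_fields_subset_iff[of "span (trig_fields G)" G] that span_superset by auto
  have form: "(\<exists>m\<in>G. \<exists>\<phi>. X = wave_field m \<phi>) \<or> (\<exists>u. X = const_field u)" if "X \<in> trig_fields G" for X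
    using that by (auto simp: trig_fields_wave)
  have cw: "lie_bracket (const_field u) (wave_field m \<phi>) \<in> span (trig_fields G)" if "m \<in> G" for u m \<phi>
    using that by (simp add: lie_bracket_const_wave span_scale w)
  have wc: "lie_bracket (wave_field m \<phi>) (const_field u) \<in> span (trig_fields G)" if "m \<in> G" for u m \<phi>
    using lie_bracket_antisym span_neg cw[OF that] by metis
  have ww: "lie_bracket (wave_field m \<phi>) (wave_field n \<psi>) \<in> span (trig_fields G)" if "m \<in> G" "n \<in> G" for m n \<phi> \<psi>
    using that by (simp add: lie_bracket_waves span_scale span_add w add minus)
  have cc: "lie_bracket (const_field u) (const_field v) \<in> span (trig_fields G)" for u v
    using span_zero[of "trig_fields G"] lie_bracketI[OF const_field_has_derivative const_field_has_derivative, of u v]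
    by (simp add: zero_fun_def)
  fix X Y assume "X \<in> trig_fields G" "Y \<in> trig_fields G"
  then show "lie_bracket X Y \<in> span (trig_fields G)"
    using form[of X] form[of Y] cw wc ww cc by blast
qed

section \<open>Isolating the modes of a Hamiltonian\<close>

text \<open>Let \<open>T\<close> be the operator with \<open>T (X i) = ev i X i\<close>. If \<open>T\<close> preserves \<open>L\<close>, so does every polynomial
  in \<open>T\<close>; the product of the \<open>T - \<nu>\<close> over the eigenvalues \<open>\<nu> \<noteq> \<mu>\<close> annihilates all summands except those of
  eigenvalue \<open>\<mu>\<close>, which it multiplies by a nonzero constant. \<open>T\<close> is given only through its effect on
  coefficients, since the bracket is linear merely on differentiable fields.\<close>

lemma eigenvector_isolation:
  fixes X :: "'i \<Rightarrow> 'v::real_vector"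
  assumes F: "finite F" and L: "subspace L"
    and stable: "\<And>c. (\<Sum>i\<in>F. c i *\<^sub>R X i) \<in> L \<Longrightarrow> (\<Sum>i\<in>F. (c i * ev i) *\<^sub>R X i) \<in> L"
    and sum: "(\<Sum>i\<in>F. X i) \<in> L"
  shows "(\<Sum>i\<in>{i\<in>F. ev i = \<mu>}. X i) \<in> L"
proof -
  \<comment> \<open>\<open>P V i\<close> is the value at \<open>ev i\<close> of the polynomial with roots \<open>V\<close>.\<close>
  define P where "P V i = (\<Prod>\<nu>\<in>V. ev i - \<nu>)" for V :: "real set" and i
  have *: "(\<Sum>i\<in>F. P V i *\<^sub>R X i) \<in> L" if "finite V" for V
    using that
  proof induction
    case empty
    then show ?case using sum by (simp add: P_def)
  next
    case (insert \<nu> V)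
    have "(\<Sum>i\<in>F. P (insert \<nu> V) i *\<^sub>R X i)
        = (\<Sum>i\<in>F. (P V i * ev i) *\<^sub>R X i) - \<nu> *\<^sub>R (\<Sum>i\<in>F. P V i *\<^sub>R X i)"
      using insert by (simp add: P_def scaleR_sum_right sum_subtractf[symmetric] algebra_simps)
    then show ?case using stable[OF insert.IH] insert.IH L by (simp add: subspace_diff subspace_scale)
  qed
  define V where "V = ev ` F - {\<mu>}"
  have V: "finite V" using F by (simp add: V_def)
  define K where "K = (\<Prod>\<nu>\<in>V. \<mu> - \<nu>)"
  have "K \<noteq> 0" using V by (auto simp: K_def V_def)
  have "(\<Sum>i\<in>F. P V i *\<^sub>R X i) = (\<Sum>i\<in>{i\<in>F. ev i = \<mu>}. P V i *\<^sub>R X i)"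
    using V F by (intro sum.mono_neutral_right) (auto simp: P_def V_def)
  also have "\<dots> = K *\<^sub>R (\<Sum>i\<in>{i\<in>F. ev i = \<mu>}. X i)"
    by (simp add: scaleR_sum_right P_def K_def)
  finally have "K *\<^sub>R (\<Sum>i\<in>{i\<in>F. ev i = \<mu>}. X i) \<in> L" using *[OF V] by simp
  from subspace_scale[OF L this, of "inverse K"] show ?thesis using \<open>K \<noteq> 0\<close> by simp
qed

text \<open>Bracketing with the constant field in the direction of \<open>m\<close> yields the quarter turn of the given
  phase with factor \<open>\<bar>m\<bar>\<^sup>2\<close>. For \<open>m = 0\<close> wave fields vanish.\<close>

lemma single_wave_generates:
  assumes L: "lie_algebra_of_fields L" and const: "\<And>u. const_field u \<in> L"
    and r: "r \<noteq> 0" "r *\<^sub>R wave_field m \<phi> \<in> L"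
  shows "wave_field m \<psi> \<in> L"
proof (cases "m = 0")
  case True
  then show ?thesis using L by (simp add: wave_field_zero lie_algebra_of_fields_def subspace_0)
next
  case False
  have sub: "subspace L" using L by (simp add: lie_algebra_of_fields_def)
  have w: "wave_field m \<phi> \<in> L"
    using subspace_scale[OF sub r(2), of "inverse r"] r(1) by simp
  have "of_lattice m \<noteq> 0" using False by (simp add: of_lattice_def prod_eq_iff zero_prod_def)
  moreover have "(of_lattice m \<bullet> of_lattice m) *\<^sub>R wave_field m (\<phi> + pi / 2) \<in> L"
    using L w const unfolding lie_bracket_const_wave[symmetric] lie_algebra_of_fields_def by blast
  from subspace_scale[OF sub this, of "inverse (of_lattice m \<bullet> of_lattice m)"]
  have "wave_field m (\<phi> + pi / 2) \<in> L" using calculation by simp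
  then show ?thesis
    using w sub unfolding wave_field_shift[of m \<psi> \<phi>] by (intro subspace_add subspace_scale)
qed

text \<open>The Hamiltonian field of \<open>q \<mapsto> Re (h\<^sub>m e\<^bsup>i\<langle>m,q\<rangle>\<^esup>)\<close>; the polar form of the coefficient exhibits it as
  a multiple of a wave field.\<close>

definition mode_field :: "(point \<Rightarrow> real) \<Rightarrow> int \<times> int \<Rightarrow> vfield" where
  "mode_field h m = cmod (fourier_coeff h m) *\<^sub>R wave_field m (Arg (fourier_coeff h m) + pi / 2)"

lemma Re_mult_cis: "Re (c * cis x) = cmod c * cos (x + Arg c)"
proof -
  have "c * cis x = rcis (cmod c) (Arg c) * cis x" by (simp only: rcis_cmod_Arg)
  also have "\<dots> = rcis (cmod c) (x + Arg c)" by (simp add: rcis_def cis_mult mult.assoc add.commute)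
  finally show ?thesis by simp
qed

lemma hamiltonian_eq_sum_modes:
  assumes "torus_smooth h" "finite (fourier_modes h)"
  shows "hamiltonian h = (\<Sum>m\<in>fourier_modes h. mode_field h m)"
proof -
  let ?c = "fourier_coeff h"
  have expansion: "(\<lambda>q. \<Sum>m\<in>fourier_modes h. cmod (?c m) * wave m (Arg (?c m)) q) = h"
    using fourier_expansion[OF assms] by (simp add: fun_eq_iff Re_mult_cis wave_def del: times_complex.sel)
  have "((\<lambda>q. \<Sum>m\<in>fourier_modes h. cmod (?c m) * wave m (Arg (?c m)) q) has_derivative
     (\<lambda>v. \<Sum>m\<in>fourier_modes h. cmod (?c m) * ((of_lattice m \<bullet> v) * wave m (Arg (?c m) + pi / 2) q))) (at q)" for q
    by (intro has_derivative_sum has_derivative_mult_right wave_has_derivative)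
  from hamiltonianI[OF this[unfolded expansion]] show ?thesis
    by (simp add: fun_eq_iff sum_fun_apply mode_field_def scaleR_fun_def wave_field_def perp_def
        of_lattice_def inner_prod_def prod_eq_iff fst_sum snd_sum sum_negf[symmetric] algebra_simps)
qed

text \<open>Since \<open>h\<close> is real, the terms of \<open>m\<close> and \<open>- m\<close> in the Fourier series are conjugate and have the same
  real part.\<close>

lemma mode_field_uminus: "mode_field h (- m) = mode_field h m"
proof
  fix q
  have *: "mode_field h n q = - Im (fourier_coeff h n * cis (of_lattice n \<bullet> q)) *\<^sub>R perp n" for n
  proof -
    have "Re (fourier_coeff h n * cis (of_lattice n \<bullet> q + pi / 2)) = - Im (fourier_coeff h n * cis (of_lattice n \<bullet> q))"
      by (simp add: cos_add sin_add)
    then show ?thesis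
      by (simp add: mode_field_def wave_field_def wave_def scaleR_fun_def Re_mult_cis add.commute add.left_commute del: times_complex.sel)
  qed
  show "mode_field h (- m) q = mode_field h m q"
    unfolding * fourier_coeff_uminus by (simp add: perp_simps of_lattice_simps algebra_simps)
qed

text \<open>A vector \<open>(1, t)\<close> with irrational \<open>t\<close> is orthogonal to no nonzero lattice vector.\<close>

lemma generic_direction:
  "\<exists>u. \<forall>k. of_lattice k \<bullet> u = 0 \<longrightarrow> k = 0"
proof -
  have "(UNIV :: real set) \<noteq> \<rat>" using uncountable_UNIV_real countable_rat by metis
  then obtain t :: real where t: "t \<notin> \<rat>" by blast
  have "k = 0" if "of_lattice k \<bullet> (1, t) = 0" for k
  proof -
    from that
    have e: "real_of_int (fst k) + real_of_int (snd k) * t = 0"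
      by (simp add: of_lattice_def inner_prod_def)
    have "snd k = 0"
    proof (rule ccontr)
      assume "snd k \<noteq> 0"
      then have "t = - real_of_int (fst k) / real_of_int (snd k)" using e by (simp add: field_simps)
      then show False using t by simp
    qed
    with e show "k = 0" by (simp add: prod_eq_iff)
  qed
  then show ?thesis by blast
qed

text \<open>For a constant field \<open>u\<close> in a generic direction, bracketing twice with \<open>u\<close> multiplies the mode \<open>m\<close>
  by \<open>- \<langle>m, u\<rangle>\<^sup>2\<close>, and these eigenvalues separate modes up to sign. The two modes of one eigenvalue
  carry the same field, so they add up to twice that field and cannot cancel.\<close>

lemma lie_algebra_contains_modes:
  assumes h: "torus_smooth h" "finite (fourier_modes h)"
    and L: "lie_algebra_of_fields L" and const: "\<And>u. const_field u \<in> L" and ham: "hamiltonian h \<in> L"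
    and n: "n \<in> fourier_modes h"
  shows "wave_field n \<psi> \<in> L"
proof (cases "n = 0")
  case True
  then show ?thesis using L by (simp add: wave_field_zero lie_algebra_of_fields_def subspace_0)
next
  case False
  let ?M = "fourier_modes h" and ?c = "fourier_coeff h"
  have sub: "subspace L" using L by (simp add: lie_algebra_of_fields_def)
  obtain u where u: "\<And>k. of_lattice k \<bullet> u = 0 \<Longrightarrow> k = 0" using generic_direction by blast
  define ev where "ev m = - (of_lattice m \<bullet> u)\<^sup>2" for m
  have "(\<Sum>m\<in>{m\<in>?M. ev m = ev n}. mode_field h m) \<in> L"
  proof (rule eigenvector_isolation[OF h(2) sub])
    show "(\<Sum>m\<in>?M. mode_field h m) \<in> L" using ham hamiltonian_eq_sum_modes[OF h] by simp
    fix c assume "(\<Sum>m\<in>?M. c m *\<^sub>R mode_field h m) \<in> L"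
    then have "lie_bracket (const_field u) (lie_bracket (const_field u) (\<Sum>m\<in>?M. c m *\<^sub>R mode_field h m)) \<in> L"
      using L const unfolding lie_algebra_of_fields_def by blast
    moreover have "lie_bracket (const_field u) (lie_bracket (const_field u) (\<Sum>m\<in>?M. c m *\<^sub>R mode_field h m))
        = (\<Sum>m\<in>?M. (c m * ev m) *\<^sub>R mode_field h m)"
      by (simp only: mode_field_def scaleR_scaleR lie_bracket_const_waves, simp only: wave_field_half_turn)
        (simp add: ev_def power2_eq_square mult_ac)
    ultimately show "(\<Sum>m\<in>?M. (c m * ev m) *\<^sub>R mode_field h m) \<in> L" by simp
  qed
  moreover have "{m\<in>?M. ev m = ev n} = {n, - n}"
  proof -
    have "m = n \<or> m = - n" if "ev m = ev n" for m
    proof -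
      from that have "of_lattice m \<bullet> u = of_lattice n \<bullet> u \<or> of_lattice m \<bullet> u = - (of_lattice n \<bullet> u)"
        by (simp add: ev_def power2_eq_iff)
      then have "of_lattice (m - n) \<bullet> u = 0 \<or> of_lattice (m + n) \<bullet> u = 0"
        by (auto simp: of_lattice_simps inner_diff_left inner_add_left)
      then show ?thesis using u by (metis eq_iff_diff_eq_0 eq_neg_iff_add_eq_0)
    qed
    moreover have "- n \<in> ?M" using n by (simp add: fourier_modes_def fourier_coeff_uminus)
    ultimately show ?thesis using n by (auto simp: ev_def of_lattice_simps)
  qed
  moreover have "n \<noteq> - n" using False by (auto simp: prod_eq_iff)
  ultimately have "(2 * cmod (?c n)) *\<^sub>R wave_field n (Arg (?c n) + pi / 2) \<in> L"
    by (simp add: mode_field_uminus) (simp add: mode_field_def scaleR_2[symmetric])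
  moreover have "2 * cmod (?c n) \<noteq> 0" using n by (simp add: fourier_modes_def)
  ultimately show ?thesis using single_wave_generates[OF L const] by blast
qed

section \<open>Modes generated by a spanning set\<close>

text \<open>A quarter turn of both phases leaves the phase of the mode \<open>m - n\<close> in the bracket fixed and turns
  that of \<open>m + n\<close> by half a circle. The difference of the two brackets therefore retains only
  \<open>m + n\<close>.\<close>

lemma wave_modes_add:
  assumes L: "lie_algebra_of_fields L"
    and "\<And>\<phi>. wave_field m \<phi> \<in> L" "\<And>\<phi>. wave_field n \<phi> \<in> L" "cross m n \<noteq> 0"
  shows "wave_field (m + n) \<phi> \<in> L"
proof -
  have sub: "subspace L" using L by (simp add: lie_algebra_of_fields_def)
  have "lie_bracket (wave_field m (\<phi> - pi / 2)) (wave_field n 0)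
      - lie_bracket (wave_field m \<phi>) (wave_field n (pi / 2)) \<in> L"
    using L assms(2,3) by (intro subspace_diff[OF sub]) (auto simp: lie_algebra_of_fields_def)
  also have "lie_bracket (wave_field m (\<phi> - pi / 2)) (wave_field n 0)
      - lie_bracket (wave_field m \<phi>) (wave_field n (pi / 2)) = real_of_int (cross m n) *\<^sub>R wave_field (m + n) \<phi>"
    by (simp only: lie_bracket_waves wave_field_half_turn scaleR_diff_right[symmetric])
      (simp add: scaleR_2[symmetric])
  finally have "inverse (real_of_int (cross m n)) *\<^sub>R real_of_int (cross m n) *\<^sub>R wave_field (m + n) \<phi> \<in> L"
    by (rule subspace_scale[OF sub])
  then show ?thesis using assms(4) by simp
qed

lemma cross_eq_zero_trans:
  assumes "m \<noteq> 0" "cross m n = 0" "cross m k = 0"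
  shows "cross n k = 0"
proof -
  have "fst m * cross n k = fst n * cross m k - fst k * cross m n"
    "snd m * cross n k = snd n * cross m k - snd k * cross m n"
    by (simp_all add: cross_def algebra_simps)
  then show ?thesis using assms by (auto simp: prod_eq_iff)
qed

lemma spanning_lattice_transversal:
  assumes "span (of_lattice ` group_closure M) = UNIV" "m \<noteq> 0"
  obtains k where "k \<in> M" "cross m k \<noteq> 0"
proof (rule ccontr)
  assume "\<not> thesis"
  then have M: "\<And>k. k \<in> M \<Longrightarrow> cross m k = 0" using that by blast
  have "cross m k = 0" if "k \<in> group_closure M" for k
    using that
  proof induction
    case (base s)
    have "cross m 0 = 0" by (simp add: cross_def)
    with base show ?case using M[of s] by auto
  next
    case (diff s t)
    have "cross m (s - t) = cross m s - cross m t" by (simp add: cross_def algebra_simps)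
    with diff.IH show ?case by simp
  qed
  then have "of_lattice ` group_closure M \<subseteq> {v. v \<bullet> perp m = 0}"
    by (auto simp: of_lattice_inner_perp)
  then have "span (of_lattice ` group_closure M) \<subseteq> {v. v \<bullet> perp m = 0}"
    by (rule span_minimal) (auto simp: subspace_def inner_add_left)
  then have "perp m \<bullet> perp m = 0" using assms(1) by blast
  then show False using assms(2) by (simp add: perp_def prod_eq_iff zero_prod_def)
qed

text \<open>The modes of which \<open>L\<close> contains all phases form a subgroup. For transversal modes closure under
  addition is the bracket formula. Parallel nonzero \<open>m\<close> and \<open>n\<close> with \<open>m + n \<noteq> 0\<close> are added by a
  detour: a mode \<open>k\<close> off their common line exists because the modes span the plane, and
  \<open>m + n = (m + k) + (n - k)\<close> uses transversal pairs only.\<close>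

lemma lie_algebra_contains_group_closure:
  assumes L: "lie_algebra_of_fields L" and M: "\<And>m \<phi>. m \<in> M \<Longrightarrow> wave_field m \<phi> \<in> L"
    and span: "span (of_lattice ` group_closure M) = UNIV" and m: "m \<in> group_closure M"
  shows "wave_field m \<phi> \<in> L"
proof -
  define N where "N = {m. \<forall>\<phi>. wave_field m \<phi> \<in> L}"
  have sub: "subspace L" using L by (simp add: lie_algebra_of_fields_def)
  have zero: "0 \<in> N" using sub by (simp add: N_def wave_field_zero subspace_0)
  have uminus: "- m \<in> N" if "m \<in> N" for m
    using that sub by (simp add: N_def wave_field_uminus subspace_neg)
  have transversal: "m + n \<in> N" if "m \<in> N" "n \<in> N" "cross m n \<noteq> 0" for m n
    using that wave_modes_add[OF L] by (simp add: N_def)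
  have add: "m + n \<in> N" if mn: "m \<in> N" "n \<in> N" for m n
  proof (cases "cross m n \<noteq> 0 \<or> m = 0 \<or> n = 0 \<or> m + n = 0")
    case True
    then show ?thesis using transversal[OF mn] mn zero by auto
  next
    case False
    then obtain k where k: "k \<in> M" "cross (m + n) k \<noteq> 0"
      using spanning_lattice_transversal[OF span] by metis
    have kN: "k \<in> N" using k(1) M by (simp add: N_def)
    have sum: "cross (m + n) k = cross m k + cross n k" by (simp add: cross_def algebra_simps)
    have nm: "cross n m = 0" using False by (simp add: cross_def algebra_simps)
    have mk: "cross m k \<noteq> 0" using cross_eq_zero_trans[of m n k] False k(2) sum by auto
    have nk: "cross n k \<noteq> 0" using cross_eq_zero_trans[of n m k] False nm k(2) sum by auto
    have "m + k \<in> N" using transversal mn(1) kN mk by blast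
    moreover have "n + - k \<in> N"
      using transversal[OF mn(2) uminus[OF kN]] nk by (simp add: cross_def)
    moreover have "cross (m + k) (n + - k) = - cross (m + n) k"
      using False by (simp add: cross_def algebra_simps)
    ultimately have "(m + k) + (n + - k) \<in> N" using transversal k(2) by (metis neg_equal_0_iff_equal)
    then show ?thesis by simp
  qed
  from m have "m \<in> N"
  proof induction
    case (base s)
    then show ?case using zero M[of s] by (auto simp: N_def)
  next
    case (diff s t)
    then show ?case using add[OF _ uminus, of s t] by simp
  qed
  then show ?thesis by (simp add: N_def)
qed

section \<open>The Lie algebra generated by a Hamiltonian field and the translations\<close>

text \<open>Differences of the generators on the left are the constant fields; the isolation of modes then
  gives the forward direction. Conversely, the Hamiltonian field of \<open>h\<close> is a linear combination
  of wave fields.\<close>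

lemma generators_subset_iff:
  assumes h: "torus_smooth h" "finite (fourier_modes h)" and L: "lie_algebra_of_fields L"
  shows "{hamiltonian h + const_field u | u. True} \<subseteq> L \<longleftrightarrow> trig_fields (fourier_modes h) \<subseteq> L"
proof -
  have sub: "subspace L" using L by (simp add: lie_algebra_of_fields_def)
  note iff = trig_fields_subset_iff[OF sub]
  show ?thesis
  proof
    assume gen: "{hamiltonian h + const_field u | u. True} \<subseteq> L"
    have c0: "const_field 0 = 0" by (simp add: const_field_def zero_fun_def)
    have "hamiltonian h + const_field 0 \<in> L" using gen by blast
    then have ham: "hamiltonian h \<in> L" by (simp add: c0)
    have const: "const_field u \<in> L" for u
    proof -
      have "hamiltonian h + const_field u \<in> L" using gen by blast
      from subspace_diff[OF sub this ham] show ?thesis by simp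
    qed
    show "trig_fields (fourier_modes h) \<subseteq> L"
      using lie_algebra_contains_modes[OF h L const ham] const by (simp add: iff)
  next
    assume "trig_fields (fourier_modes h) \<subseteq> L"
    then have "mode_field h m \<in> L" if "m \<in> fourier_modes h" for m
      using that sub by (simp add: iff mode_field_def subspace_scale)
    then have "hamiltonian h \<in> L"
      unfolding hamiltonian_eq_sum_modes[OF h] by (rule subspace_sum[OF sub])
    then show "{hamiltonian h + const_field u | u. True} \<subseteq> L"
      using \<open>trig_fields _ \<subseteq> L\<close> sub by (auto simp: iff subspace_add)
  qed
qed

theorem theorem6:
  fixes h :: "real \<times> real \<Rightarrow> real"
    and \<Gamma> :: "(int \<times> int) set"
  assumes "torus_smooth h"
    and "finite (fourier_modes h)"
    and "\<Gamma> = group_closure (fourier_modes h)"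
  shows "(span (of_lattice ` \<Gamma>) = UNIV \<longrightarrow>
            Lie {hamiltonian h + const_field u | u. True} = span (trig_fields \<Gamma>)) \<and>
         (dim (span (of_lattice ` \<Gamma>)) = 1 \<longrightarrow>
            Lie {hamiltonian h + const_field u | u. True} = Lie (trig_fields (fourier_modes h)))"
proof -
  let ?M = "fourier_modes h"
  have Lie_eq: "Lie {hamiltonian h + const_field u | u. True} = Lie (trig_fields ?M)"
  proof -
    have "lie_algebra_of_fields L \<and> {hamiltonian h + const_field u | u. True} \<subseteq> L \<longleftrightarrow>
        lie_algebra_of_fields L \<and> trig_fields ?M \<subseteq> L" for L
      using generators_subset_iff[OF assms(1,2)] by blast
    then show ?thesis unfolding Lie_def hull_def by (simp only:)
  qed
  moreover have "Lie (trig_fields ?M) = span (trig_fields \<Gamma>)" if span: "span (of_lattice ` \<Gamma>) = UNIV"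
  proof
    have "?M \<subseteq> \<Gamma>" unfolding assms(3) by (auto intro: group_closure.base)
    then have "trig_fields ?M \<subseteq> trig_fields \<Gamma>" by (auto simp: trig_fields_def)
    moreover have "lie_algebra_of_fields (span (trig_fields \<Gamma>))"
      unfolding assms(3) by (intro lie_algebra_trig_fields group_closure.diff group_closure_add)
    ultimately show "Lie (trig_fields ?M) \<subseteq> span (trig_fields \<Gamma>)"
      unfolding Lie_def by (intro hull_minimal order_trans[OF _ span_superset])
    show "span (trig_fields \<Gamma>) \<subseteq> Lie (trig_fields ?M)"
      unfolding Lie_def hull_def
    proof (rule Inter_greatest, clarify)
      fix X L assume X: "X \<in> span (trig_fields \<Gamma>)" and L: "lie_algebra_of_fields L" and M: "trig_fields ?M \<subseteq> L"
      have sub: "subspace L" using L by (simp add: lie_algebra_of_fields_def)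
      from M have waves: "wave_field m \<phi> \<in> L" if "m \<in> ?M" for m \<phi>
        using that by (simp add: trig_fields_subset_iff[OF sub])
      have "wave_field m \<phi> \<in> L" if "m \<in> \<Gamma>" for m \<phi>
        using lie_algebra_contains_group_closure[OF L waves] span that unfolding assms(3) by simp
      with M have "trig_fields \<Gamma> \<subseteq> L"
        by (simp add: trig_fields_subset_iff[OF sub])
      from span_minimal[OF this sub] X show "X \<in> L" ..
    qed
  qed
  ultimately show ?thesis by simp
qed

end
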